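(* Let $V$ be a three-Higgs-doublet potential, written in bilinear form as $V = M_0 r_0 + M_i r_i + \Lambda_0 r_0^2 + L_i r_0 r_i + \Lambda_{ij} r_i r_j$, which possesses a CP4 symmetry and no CP2 symmetry, and suppose at least one of the vectors $M$, $L$, $K^{(n)}$ ($n\ge1$), where $K^{(n)}_i=d_{ijk}(\Lambda^n)_{jk}$, is nonzero. Let $\langle\phi_a\rangle=v_a$ be a (nonzero, neutral) vector of vacuum expectation values, $v\in\mathbb{C}^3\setminus\{0\}$, and let $\langle r\rangle\in\mathbb{R}^8$ be the corresponding vector with components $\langle r_i\rangle=v_a^*(t_i)_{ab}v_b$. Then the CP4 symmetry is conserved by the vacuum if and only if $\langle r\rangle$ is self-aligned and parallel to (the nonzero ones among) $M$, $L$ and the $K^{(n)}$, and is therefore an eigenvector of $\Lambda$. If this property does not hold, CP4 is spontaneously broken.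
   Context: Setting. There are three Higgs doublets $\phi_a\in\mathbb{C}^2$, $a=1,2,3$, and the (real-valued) potential is $V=Y_{ab}(\phi_a^\dagger\phi_b)+Z_{abcd}(\phi_a^\dagger\phi_b)(\phi_c^\dagger\phi_d)$ (repeated indices summed). Let $t_i=\lambda_i/2$, $i=1,\dots,8$, with $\lambda_i$ the standard Gell-Mann matrices. The tensors $f_{ijk}$ (totally antisymmetric) and $d_{ijk}$ (totally symmetric) are defined by $[t_i,t_j]=i f_{ijk}t_k$ and $\{t_i,t_j\}=\frac13\delta_{ij}\mathbf{1}_3+d_{ijk}t_k$. The bilinears are $r_0=\frac{1}{\sqrt3}\phi_a^\dagger\phi_a$ and $r_i=\phi_a^\dagger(t_i)_{ab}\phi_b$. Every potential $V$ can be written uniquely as $V = M_0 r_0 + M_i r_i + \Lambda_0 r_0^2 + L_i r_0 r_i + \Lambda_{ij} r_i r_j$ with real coefficients and $\Lambda_{ij}=\Lambda_{ji}$. Self-alignment. A nonzero vector $a\in\mathbb{R}^8$ is self-aligned if the vector with components $d_{ijk}a_ja_k$ is parallel to $a$. CP symmetries. A (generalized) $CP$ transformation is a map $\phi_a\mapsto X_{ab}\phi_b^*$ with $X$ a unitary $3\times3$ matrix ($*$ is componentwise complex conjugation of the doublets; the space-time argument is suppressed). It is a symmetry of $V$ if $V$ is invariant under it. Applying it twice gives $\phi_a\mapsto (XX^* )_{ab}\phi_b$; under a unitary basis change $\phi\mapsto U\phi$, $X\mapsto UXU^{T}$. It has order 2 (CP2) if $XX^*=\mathbf 1$, and order 4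 (CP4) if $XX^*\neq\mathbf 1$ and $(XX^* )^2=\mathbf 1$; for a CP4 there is a basis in which $X=\begin{pmatrix}0&1&0\\-1&0&0\\0&0&1\end{pmatrix}$. Vacuum. A neutral vacuum is $\langle\phi_a\rangle=(0,v_a)^T$ with $v_a\in\mathbb{C}$ (up to normalization). The CP4 symmetry with matrix $X$ is conserved by the vacuum if $Xv^*=e^{i\theta}v$ for some real $\theta$ (invariance up to a global phase transformation); otherwise it is spontaneously broken. *)

theory Defs
  imports "HOL-Analysis.Analysis"
begin

subsection \<open>Complex 3x3 matrices and the Gell-Mann basis\<close>

definition cnj_vec :: "complex^'n \<Rightarrow> complex^'n" where
  "cnj_vec v = (\<chi> a. cnj (v $ a))"

definition cnj_mat :: "complex^'n^'m \<Rightarrow> complex^'n^'m" where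
  "cnj_mat A = (\<chi> a b. cnj (A $ a $ b))"

definition unitary :: "complex^'n^'n \<Rightarrow> bool" where
  "unitary X \<longleftrightarrow> X ** transpose (cnj_mat X) = mat 1 \<and> transpose (cnj_mat X) ** X = mat 1"

text \<open>The index type 8 has the elements 1, ..., 7 and 8 = 0, and the function vector lists
  the components 1, ..., 8 in this order; likewise for the index type 3.\<close>

definition gell_mann :: "8 \<Rightarrow> complex^3^3" where
  "gell_mann i = (vector [
     vector [vector [0, 1, 0], vector [1, 0, 0], vector [0, 0, 0]],
     vector [vector [0, - \<i>, 0], vector [\<i>, 0, 0], vector [0, 0, 0]],
     vector [vector [1, 0, 0], vector [0, - 1, 0], vector [0, 0, 0]],
     vector [vector [0, 0, 1], vector [0, 0, 0], vector [1, 0, 0]],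
     vector [vector [0, 0, - \<i>], vector [0, 0, 0], vector [\<i>, 0, 0]],
     vector [vector [0, 0, 0], vector [0, 0, 1], vector [0, 1, 0]],
     vector [vector [0, 0, 0], vector [0, 0, - \<i>], vector [0, \<i>, 0]],
     (1 / sqrt 3) *\<^sub>R vector [vector [1, 0, 0], vector [0, 1, 0], vector [0, 0, - 2]]]
     :: complex^3^3^8) $ i"

definition gen :: "8 \<Rightarrow> complex^3^3" where
  "gen i = (1/2) *\<^sub>R gell_mann i"

definition is_d_tensor :: "(8 \<Rightarrow> 8 \<Rightarrow> 8 \<Rightarrow> real) \<Rightarrow> bool" where
  "is_d_tensor d \<longleftrightarrow> (\<forall>i j. gen i ** gen j + gen j ** gen i =
     (if i = j then 1/3 else 0) *\<^sub>R mat 1 + (\<Sum>k\<in>UNIV. d i j k *\<^sub>R gen k))"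

definition d_tensor :: "8 \<Rightarrow> 8 \<Rightarrow> 8 \<Rightarrow> real" where
  "d_tensor = (THE d. is_d_tensor d)"

lemma exhaust_8: "(x::8) = 1 \<or> x = 2 \<or> x = 3 \<or> x = 4 \<or> x = 5 \<or> x = 6 \<or> x = 7 \<or> x = 8"
proof (induct x)
  case (of_int z)
  then have "0 \<le> z" and "z < 8" by simp_all
  then have "z = 0 \<or> z = 1 \<or> z = 2 \<or> z = 3 \<or> z = 4 \<or> z = 5 \<or> z = 6 \<or> z = 7" by arith
  then show ?case by auto
qed

lemma UNIV_8: "UNIV = {1, 2, 3, 4, 5, 6, 7, 8::8}"
  using exhaust_8 by auto

lemma sum_8: "sum f (UNIV::8 set) = f 1 + f 2 + f 3 + f 4 + f 5 + f 6 + f 7 + f 8"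
  unfolding UNIV_8 by (simp add: ac_simps)

lemma forall_8: "(\<forall>i::8. P i) \<longleftrightarrow> P 1 \<and> P 2 \<and> P 3 \<and> P 4 \<and> P 5 \<and> P 6 \<and> P 7 \<and> P 8"
  by (metis exhaust_8)

lemma gell_mann_simps:
  "gell_mann 1 = vector [vector [0, 1, 0], vector [1, 0, 0], vector [0, 0, 0]]"
  "gell_mann 2 = vector [vector [0, - \<i>, 0], vector [\<i>, 0, 0], vector [0, 0, 0]]"
  "gell_mann 3 = vector [vector [1, 0, 0], vector [0, - 1, 0], vector [0, 0, 0]]"
  "gell_mann 4 = vector [vector [0, 0, 1], vector [0, 0, 0], vector [1, 0, 0]]"
  "gell_mann 5 = vector [vector [0, 0, - \<i>], vector [0, 0, 0], vector [\<i>, 0, 0]]"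
  "gell_mann 6 = vector [vector [0, 0, 0], vector [0, 0, 1], vector [0, 1, 0]]"
  "gell_mann 7 = vector [vector [0, 0, 0], vector [0, 0, - \<i>], vector [0, \<i>, 0]]"
  "gell_mann 8 = (1 / sqrt 3) *\<^sub>R vector [vector [1, 0, 0], vector [0, 1, 0], vector [0, 0, - 2]]"
  unfolding gell_mann_def vector_def by simp_all

lemma gen_hermitian: "cnj (gen i $ a $ b) = gen i $ b $ a"
proof -
  have "\<forall>a b. cnj (gen i $ a $ b) = gen i $ b $ a"
    using exhaust_8[of i] by (elim disjE; simp add: gen_def gell_mann_simps forall_3)
  then show ?thesis by blast
qed

lemma trace_gen_mult:
  fixes H :: "complex^3^3"
  defines "T \<equiv> \<lambda>k. \<Sum>a\<in>UNIV. \<Sum>b\<in>UNIV. H $ a $ b * gen k $ b $ a"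
  shows "T 1 = (H $ 1 $ 2 + H $ 2 $ 1) / 2" "T 2 = \<i> * (H $ 1 $ 2 - H $ 2 $ 1) / 2"
    "T 3 = (H $ 1 $ 1 - H $ 2 $ 2) / 2"
    "T 4 = (H $ 1 $ 3 + H $ 3 $ 1) / 2" "T 5 = \<i> * (H $ 1 $ 3 - H $ 3 $ 1) / 2"
    "T 6 = (H $ 2 $ 3 + H $ 3 $ 2) / 2" "T 7 = \<i> * (H $ 2 $ 3 - H $ 3 $ 2) / 2"
    "T 8 = (1 / (2 * sqrt 3)) *\<^sub>R (H $ 1 $ 1 + H $ 2 $ 2 - 2 * H $ 3 $ 3)"
  unfolding T_def gen_def sum_3
  by (simp_all add: gell_mann_simps complex_eq_iff field_simps)

lemma trace_gen_gen:
  "(\<Sum>a\<in>UNIV. \<Sum>b\<in>UNIV. gen i $ a $ b * gen j $ b $ a) = (if i = j then 1/2 else 0)"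
  using exhaust_8[of j]
  apply (elim disjE; simp only: trace_gen_mult)
         apply (insert exhaust_8[of i])
         apply (elim disjE; simp add: gen_def gell_mann_simps complex_eq_iff field_simps)+
  done

lemma hermitian_expansion:
  fixes H :: "complex^3^3"
  assumes H: "\<And>a b. cnj (H $ a $ b) = H $ b $ a"
  shows "H = (Re (\<Sum>a\<in>UNIV. H $ a $ a) / 3) *\<^sub>R mat 1 +
    (\<Sum>k\<in>UNIV. (2 * Re (\<Sum>a\<in>UNIV. \<Sum>b\<in>UNIV. H $ a $ b * gen k $ b $ a)) *\<^sub>R gen k)"
proof -
  have H': "Im (H $ 1 $ 1) = 0" "Im (H $ 2 $ 2) = 0" "Im (H $ 3 $ 3) = 0"
       "H $ 2 $ 1 = cnj (H $ 1 $ 2)" "H $ 3 $ 1 = cnj (H $ 1 $ 3)" "H $ 3 $ 2 = cnj (H $ 2 $ 3)"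
    using H[of 1 1] H[of 2 2] H[of 3 3] H[of 1 2] H[of 1 3] H[of 2 3]
    by (auto simp: complex_eq_iff)
  show ?thesis
    unfolding sum_8 trace_gen_mult
    by (simp add: vec_eq_iff forall_3 sum_3 gen_def gell_mann_simps mat_def complex_eq_iff H')
       (simp add: field_simps)
qed

lemma gen_independent:
  assumes "(\<Sum>k\<in>UNIV. c k *\<^sub>R gen k) = (\<Sum>k\<in>UNIV. c' k *\<^sub>R gen k)"
  shows "c = c'"
proof -
  have "\<forall>k. c k = c' k"
    using assms
    by (simp add: vec_eq_iff forall_3 forall_8 sum_8 gen_def gell_mann_simps complex_eq_iff)
  then show ?thesis by blast
qed

lemma is_d_tensor_unique:
  assumes "is_d_tensor d" "is_d_tensor d'"
  shows "d = d'"
proof (intro ext)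
  fix i j k
  have "(\<Sum>k\<in>UNIV. d i j k *\<^sub>R gen k) = (\<Sum>k\<in>UNIV. d' i j k *\<^sub>R gen k)"
    using assms[unfolded is_d_tensor_def, rule_format, of i j] by (simp only: add_left_cancel)
  then show "d i j k = d' i j k"
    by (rule gen_independent[THEN fun_cong])
qed

lemma ex_d_tensor: "\<exists>d. is_d_tensor d"
proof
  let ?A = "\<lambda>i j. gen i ** gen j + gen j ** gen i"
  let ?d = "\<lambda>i j k. 2 * Re (\<Sum>a\<in>UNIV. \<Sum>b\<in>UNIV. ?A i j $ a $ b * gen k $ b $ a)"
  show "is_d_tensor ?d"
    unfolding is_d_tensor_def
  proof (intro allI)
    fix i j
    have herm: "cnj (?A i j $ a $ b) = ?A i j $ b $ a" for a b
      by (simp add: matrix_matrix_mult_def gen_hermitian mult.commute)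
    have "(\<Sum>a\<in>UNIV. ?A i j $ a $ a) =
        (\<Sum>a\<in>UNIV. \<Sum>b\<in>UNIV. gen i $ a $ b * gen j $ b $ a) +
        (\<Sum>a\<in>UNIV. \<Sum>b\<in>UNIV. gen j $ a $ b * gen i $ b $ a)"
      by (simp add: matrix_matrix_mult_def sum.distrib)
    also have "\<dots> = (if i = j then 1 else 0)"
      by (simp add: trace_gen_gen)
    finally have "Re (\<Sum>a\<in>UNIV. ?A i j $ a $ a) / 3 = (if i = j then 1/3 else 0)"
      by simp
    then show "?A i j = (if i = j then 1/3 else 0) *\<^sub>R mat 1 + (\<Sum>k\<in>UNIV. ?d i j k *\<^sub>R gen k)"
      using hermitian_expansion[of "?A i j", OF herm] by (simp only:)
  qed
qed

lemma d_tensor: "is_d_tensor d_tensor"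
proof -
  have "\<exists>!d. is_d_tensor d"
    using ex_d_tensor is_d_tensor_unique by blast
  then show ?thesis
    unfolding d_tensor_def by (rule theI'[where P = is_d_tensor])
qed


subsection \<open>Doublets, bilinears and the potential\<close>

text \<open>A configuration of the three doublets: the first index is the doublet index,
  the second one is the component within the doublet.\<close>

type_synonym doublets = "complex^2^3"

definition doublet_prod :: "complex^2 \<Rightarrow> complex^2 \<Rightarrow> complex" where
  "doublet_prod x y = (\<Sum>\<alpha>\<in>UNIV. cnj (x $ \<alpha>) * y $ \<alpha>)"

definition higgs_potential ::
  "complex^3^3 \<Rightarrow> (3 \<Rightarrow> 3 \<Rightarrow> 3 \<Rightarrow> 3 \<Rightarrow> complex) \<Rightarrow> doublets \<Rightarrow> complex" where
  "higgs_potential Y Z \<phi> =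
     (\<Sum>a\<in>UNIV. \<Sum>b\<in>UNIV. Y $ a $ b * doublet_prod (\<phi> $ a) (\<phi> $ b)) +
     (\<Sum>a\<in>UNIV. \<Sum>b\<in>UNIV. \<Sum>c\<in>UNIV. \<Sum>d\<in>UNIV.
        Z a b c d * doublet_prod (\<phi> $ a) (\<phi> $ b) * doublet_prod (\<phi> $ c) (\<phi> $ d))"

definition is_3hdm_potential :: "(doublets \<Rightarrow> real) \<Rightarrow> bool" where
  "is_3hdm_potential V \<longleftrightarrow>
     (\<exists>Y Z. \<forall>\<phi>. complex_of_real (V \<phi>) = higgs_potential Y Z \<phi>)"

text \<open>The bilinears are real because the generators are Hermitian (see bilin_complex), so
  taking real parts only changes the type.\<close>

definition bilin0 :: "doublets \<Rightarrow> real" where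
  "bilin0 \<phi> = 1 / sqrt 3 * Re (\<Sum>a\<in>UNIV. doublet_prod (\<phi> $ a) (\<phi> $ a))"

definition bilin :: "doublets \<Rightarrow> real^8" where
  "bilin \<phi> = (\<chi> i. Re (\<Sum>a\<in>UNIV. \<Sum>b\<in>UNIV. gen i $ a $ b * doublet_prod (\<phi> $ a) (\<phi> $ b)))"

definition bilinear_form ::
  "real \<Rightarrow> real^8 \<Rightarrow> real \<Rightarrow> real^8 \<Rightarrow> real^8^8 \<Rightarrow> doublets \<Rightarrow> real" where
  "bilinear_form M0 M \<Lambda>0 L \<Lambda> \<phi> =
     M0 * bilin0 \<phi> + (\<Sum>i\<in>UNIV. M $ i * bilin \<phi> $ i) + \<Lambda>0 * (bilin0 \<phi>)\<^sup>2
     + (\<Sum>i\<in>UNIV. L $ i * bilin0 \<phi> * bilin \<phi> $ i)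
     + (\<Sum>i\<in>UNIV. \<Sum>j\<in>UNIV. \<Lambda> $ i $ j * bilin \<phi> $ i * bilin \<phi> $ j)"


subsection \<open>Self-alignment and the vectors K\<close>

definition parallel :: "real^8 \<Rightarrow> real^8 \<Rightarrow> bool" where
  "parallel x y \<longleftrightarrow> (\<exists>c. x = c *\<^sub>R y)"

definition d_product :: "real^8 \<Rightarrow> real^8 \<Rightarrow> real^8" where
  "d_product x y = (\<chi> i. \<Sum>j\<in>UNIV. \<Sum>k\<in>UNIV. d_tensor i j k * x $ j * y $ k)"

definition self_aligned :: "real^8 \<Rightarrow> bool" where
  "self_aligned a \<longleftrightarrow> a \<noteq> 0 \<and> parallel (d_product a a) a"

text \<open>Powers are taken with respect to the matrix product; the power operation of the type class
  would be componentwise on vectors.\<close>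

definition mat_pow :: "real^'n^'n \<Rightarrow> nat \<Rightarrow> real^'n^'n" where
  "mat_pow A n = ((\<lambda>B. A ** B) ^^ n) (mat 1)"

definition K_vec :: "real^8^8 \<Rightarrow> nat \<Rightarrow> real^8" where
  "K_vec \<Lambda> n = (\<chi> i. \<Sum>j\<in>UNIV. \<Sum>k\<in>UNIV. d_tensor i j k * mat_pow \<Lambda> n $ j $ k)"

definition is_eigenvector :: "real^'n^'n \<Rightarrow> real^'n \<Rightarrow> bool" where
  "is_eigenvector A x \<longleftrightarrow> x \<noteq> 0 \<and> (\<exists>\<mu>. A *v x = \<mu> *\<^sub>R x)"


subsection \<open>CP symmetries and the vacuum\<close>

definition cp_transform :: "complex^3^3 \<Rightarrow> doublets \<Rightarrow> doublets" where
  "cp_transform X \<phi> = (\<chi> a. \<Sum>b\<in>UNIV. X $ a $ b *s cnj_vec (\<phi> $ b))"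

definition cp_symmetry :: "(doublets \<Rightarrow> real) \<Rightarrow> complex^3^3 \<Rightarrow> bool" where
  "cp_symmetry V X \<longleftrightarrow> unitary X \<and> (\<forall>\<phi>. V (cp_transform X \<phi>) = V \<phi>)"

definition cp2_symmetry :: "(doublets \<Rightarrow> real) \<Rightarrow> complex^3^3 \<Rightarrow> bool" where
  "cp2_symmetry V X \<longleftrightarrow> cp_symmetry V X \<and> X ** cnj_mat X = mat 1"

definition cp4_symmetry :: "(doublets \<Rightarrow> real) \<Rightarrow> complex^3^3 \<Rightarrow> bool" where
  "cp4_symmetry V X \<longleftrightarrow> cp_symmetry V X \<and> X ** cnj_mat X \<noteq> mat 1 \<and>
     (X ** cnj_mat X) ** (X ** cnj_mat X) = mat 1"

definition neutral_vacuum :: "complex^3 \<Rightarrow> doublets" where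
  "neutral_vacuum v = (\<chi> a. vector [0, v $ a])"

definition vev_bilin :: "complex^3 \<Rightarrow> real^8" where
  "vev_bilin v = (\<chi> i. Re (\<Sum>a\<in>UNIV. \<Sum>b\<in>UNIV. cnj (v $ a) * gen i $ a $ b * v $ b))"

definition cp_conserved :: "complex^3^3 \<Rightarrow> complex^3 \<Rightarrow> bool" where
  "cp_conserved X v \<longleftrightarrow> (\<exists>\<theta>::real. X *v cnj_vec v = cis \<theta> *s v)"

definition cp_spontaneously_broken :: "complex^3^3 \<Rightarrow> complex^3 \<Rightarrow> bool" where
  "cp_spontaneously_broken X v \<longleftrightarrow> \<not> cp_conserved X v"

definition vev_aligned :: "real^8 \<Rightarrow> real^8 \<Rightarrow> real^8^8 \<Rightarrow> real^8 \<Rightarrow> bool" where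
  "vev_aligned M L \<Lambda> r \<longleftrightarrow> self_aligned r
     \<and> (M \<noteq> 0 \<longrightarrow> parallel r M)
     \<and> (L \<noteq> 0 \<longrightarrow> parallel r L)
     \<and> (\<forall>n\<ge>1. K_vec \<Lambda> n \<noteq> 0 \<longrightarrow> parallel r (K_vec \<Lambda> n))"

lemma cnj_doublet_prod: "cnj (doublet_prod x y) = doublet_prod y x"
  by (simp add: doublet_prod_def mult.commute)

lemma bilin_complex:
  "complex_of_real (bilin \<phi> $ i) =
     (\<Sum>a\<in>UNIV. \<Sum>b\<in>UNIV. gen i $ a $ b * doublet_prod (\<phi> $ a) (\<phi> $ b))" (is "_ = ?s")
proof -
  have "cnj ?s = (\<Sum>a\<in>UNIV. \<Sum>b\<in>UNIV. gen i $ b $ a * doublet_prod (\<phi> $ b) (\<phi> $ a))"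
    by (simp only: cnj_sum complex_cnj_mult gen_hermitian cnj_doublet_prod)
  also have "\<dots> = ?s"
    by (rule sum.swap)
  finally have "complex_of_real (Re ?s) = ?s"
    by (simp only: Reals_cnj_iff[symmetric] of_real_Re)
  then show ?thesis
    by (simp only: bilin_def vec_lambda_beta)
qed

lemma bilin_neutral_vacuum: "bilin (neutral_vacuum v) = vev_bilin v"
proof -
  have "doublet_prod (neutral_vacuum v $ a) (neutral_vacuum v $ b) = cnj (v $ a) * v $ b" for a b
    by (simp add: doublet_prod_def neutral_vacuum_def sum_2)
  then show ?thesis
    by (simp only: bilin_def vev_bilin_def mult.assoc mult.left_commute)
qed

end

theory Submission
  imports Defs
begin

text \<open>
  A CP transformation with matrix X acts on Hermitian matrices by H \<mapsto> X H* X\<dagger>, hence by an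
  orthogonal matrix R on the coordinates in \<real>^8. This map is multiplicative and
  conjugates traces, so R leaves the d-tensor invariant; since the coefficients of the potential
  are unique, R also fixes M and L and commutes with \<Lambda>, so it fixes all vectors K. A vacuum
  conserves CP exactly if R fixes its vector of bilinears, because v v\<dagger> determines v up to a phase.
  For a CP4, the antiunitary map J v = X v* has the square W = X X*, with a one-dimensional eigenspace
  for 1 and a two-dimensional one for -1, spanned by u and J u (Kramers degeneracy). A Hermitian matrix
  that commutes with J is scalar on both, so the traceless ones form a line: the fixed space of R is
  one-dimensional, and nonzero fixed vectors are all parallel.
\<close>

subsection \<open>The action of a CP transformation on Hermitian matrices\<close>

definition adj_mat :: "complex^'n^'m \<Rightarrow> complex^'m^'n" where
  "adj_mat A = transpose (cnj_mat A)"

text \<open>The outer product of \<open>v\<close> with itself goes to that of \<open>X v*\<close>.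
  The conjugation makes the map linear over the reals only.\<close>

definition cp_conj :: "complex^'n^'n \<Rightarrow> complex^'n^'n \<Rightarrow> complex^'n^'n" where
  "cp_conj X H = X ** cnj_mat H ** adj_mat X"

lemma cnj_mat_mult: "cnj_mat (A ** B) = cnj_mat A ** cnj_mat B"
  by (simp add: cnj_mat_def matrix_matrix_mult_def vec_eq_iff)

lemma cnj_mat_cnj_mat [simp]: "cnj_mat (cnj_mat A) = A"
  by (simp add: cnj_mat_def vec_eq_iff)

lemma cnj_mat_mat_1 [simp]: "cnj_mat (mat 1) = mat 1"
  by (simp add: cnj_mat_def mat_def vec_eq_iff)

lemma adj_mat_mult: "adj_mat (A ** B) = adj_mat B ** adj_mat A"
  by (simp add: adj_mat_def cnj_mat_mult matrix_transpose_mul)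

lemma adj_mat_adj_mat [simp]: "adj_mat (adj_mat A) = A"
  by (simp add: adj_mat_def cnj_mat_def transpose_def vec_eq_iff)

lemma adj_mat_cnj_mat: "adj_mat (cnj_mat A) = cnj_mat (adj_mat A)"
  by (simp add: adj_mat_def cnj_mat_def transpose_def vec_eq_iff)

lemma trace_cnj_mat: "trace (cnj_mat A) = cnj (trace A)"
  by (simp add: trace_def cnj_mat_def)

lemma unitary_adj_mat: "unitary X \<longleftrightarrow> X ** adj_mat X = mat 1 \<and> adj_mat X ** X = mat 1"
  by (simp add: unitary_def adj_mat_def)

lemma linear_cp_conj: "linear (cp_conj X)"
  by (rule linearI)
    (simp_all add: cp_conj_def cnj_mat_def matrix_matrix_mult_def vec_eq_iff algebra_simps
      sum.distrib scaleR_sum_right sum_distrib_left)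

text \<open>\<open>H\<close> is conjugated entrywise and not transposed, so the order of the factors
  survives; unitarity cancels the inner pair.\<close>

lemma cp_conj_mult:
  assumes "unitary X"
  shows "cp_conj X A ** cp_conj X B = cp_conj X (A ** B)"
proof -
  have "cp_conj X A ** cp_conj X B =
      X ** cnj_mat A ** (adj_mat X ** X) ** cnj_mat B ** adj_mat X"
    by (simp add: cp_conj_def matrix_mul_assoc)
  also have "\<dots> = cp_conj X (A ** B)"
    using assms by (simp add: unitary_adj_mat cp_conj_def cnj_mat_mult matrix_mul_assoc)
  finally show ?thesis .
qed

lemma trace_cp_conj:
  assumes "unitary X"
  shows "trace (cp_conj X A) = cnj (trace A)"
proof -
  have "trace (cp_conj X A) = trace (adj_mat X ** (X ** cnj_mat A))"
    unfolding cp_conj_def by (rule trace_mul_sym)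
  also have "\<dots> = cnj (trace A)"
    using assms by (simp add: unitary_adj_mat matrix_mul_assoc trace_cnj_mat)
  finally show ?thesis .
qed

lemma adj_mat_cp_conj: "adj_mat H = H \<Longrightarrow> adj_mat (cp_conj X H) = cp_conj X H"
  by (simp add: cp_conj_def adj_mat_mult adj_mat_cnj_mat matrix_mul_assoc)

lemma cp_conj_mat_1: "unitary X \<Longrightarrow> cp_conj X (mat 1) = mat 1"
  by (simp add: cp_conj_def unitary_adj_mat)

subsection \<open>Coordinates in the Gell-Mann basis\<close>

definition su3 :: "real^8 \<Rightarrow> complex^3^3" where
  "su3 x = (\<Sum>k\<in>UNIV. x $ k *\<^sub>R gen k)"

text \<open>This normalization is that of the bilinears. Since tr(t_i t_j) is 1/2 for i = j, it
  inverts \<open>su3\<close> only up to a factor 1/2, the source of the factors 2 below.\<close>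

definition hcoord :: "complex^3^3 \<Rightarrow> real^8" where
  "hcoord H = (\<chi> k. Re (trace (H ** gen k)))"

lemma linear_trace: "linear (trace :: complex^'n^'n \<Rightarrow> complex)"
  by (rule linearI) (simp_all add: trace_def sum.distrib scaleR_sum_right)

lemma linear_matrix_mult_left: "linear (\<lambda>A. A ** (B :: complex^'n^'n))"
  by (rule linearI)
    (simp_all add: matrix_matrix_mult_def vec_eq_iff algebra_simps sum.distrib scaleR_sum_right)

lemma linear_matrix_mult_right: "linear (\<lambda>B. (A :: complex^'n^'n) ** B)"
  by (rule linearI)
    (simp_all add: matrix_matrix_mult_def vec_eq_iff algebra_simps sum.distrib scaleR_sum_right)

lemma linear_su3: "linear su3"
  by (rule linearI) (simp_all add: su3_def algebra_simps sum.distrib scaleR_sum_right)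

lemma linear_hcoord: "linear hcoord"
  by (rule linearI)
    (simp_all add: hcoord_def vec_eq_iff linear_add[OF linear_matrix_mult_left]
      linear_cmul[OF linear_matrix_mult_left] linear_add[OF linear_trace] linear_cmul[OF linear_trace])

lemma trace_mult: "trace (A ** B) = (\<Sum>a\<in>UNIV. \<Sum>b\<in>UNIV. A $ a $ b * B $ b $ a)"
  by (simp add: trace_def matrix_matrix_mult_def)

lemma trace_gen_mult_gen: "trace (gen i ** gen j) = (if i = j then 1/2 else 0)"
  unfolding trace_mult by (rule trace_gen_gen)

lemma trace_gen: "trace (gen i) = 0"
proof -
  have "\<forall>i. trace (gen i) = 0"
    by (simp add: forall_8 trace_def sum_3 gen_def gell_mann_simps)
  then show ?thesis by blast
qed

lemma trace_su3: "trace (su3 x) = 0"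
  by (simp add: su3_def linear_sum[OF linear_trace] linear_cmul[OF linear_trace] trace_gen)

lemma adj_mat_su3: "adj_mat (su3 x) = su3 x"
  by (simp add: su3_def adj_mat_def transpose_def cnj_mat_def gen_hermitian vec_eq_iff)

lemma hcoord_su3: "hcoord (su3 x) = (1/2) *\<^sub>R x"
proof -
  have "trace (su3 x ** gen k) = complex_of_real (x $ k) / 2" for k
    by (simp add: su3_def linear_sum[OF linear_matrix_mult_left]
        linear_cmul[OF linear_matrix_mult_left] linear_sum[OF linear_trace]
        linear_cmul[OF linear_trace] trace_gen_mult_gen if_distrib
        scaleR_conv_of_real[where 'a=complex] cong: if_cong)
  then have "Re (trace (su3 x ** gen k)) = x $ k / 2" for k
    by (metis Re_complex_of_real of_real_divide of_real_numeral)
  then show ?thesis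
    by (simp add: hcoord_def vec_eq_iff)
qed

lemma trace_su3_mult: "trace (su3 x ** su3 y) = complex_of_real (x \<bullet> y) / 2"
  by (simp add: su3_def linear_sum[OF linear_matrix_mult_left]
        linear_cmul[OF linear_matrix_mult_left] linear_sum[OF linear_trace]
        linear_sum[OF linear_matrix_mult_right]
        linear_cmul[OF linear_matrix_mult_right]
        linear_cmul[OF linear_trace] trace_gen_mult_gen if_distrib scaleR_conv_of_real[where 'a=complex]
        inner_vec_def sum_divide_distrib mult.commute cong: if_cong)

lemma hermitian_eq_su3:
  assumes "adj_mat H = H"
  shows "H = (Re (trace H) / 3) *\<^sub>R mat 1 + 2 *\<^sub>R su3 (hcoord H)"
proof -
  have "cnj (H $ a $ b) = H $ b $ a" for a b
    using arg_cong[OF assms, of "\<lambda>A. A $ b $ a"]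
    by (simp add: adj_mat_def transpose_def cnj_mat_def)
  then show ?thesis
    using hermitian_expansion[of H]
    by (simp add: su3_def hcoord_def trace_mult scaleR_sum_right) (simp add: trace_def)
qed

definition cp_rot :: "complex^3^3 \<Rightarrow> real^8^8" where
  "cp_rot X = matrix (\<lambda>x. 2 *\<^sub>R hcoord (cp_conj X (su3 x)))"

lemma su3_cp_rot:
  assumes "unitary X"
  shows "su3 (cp_rot X *v x) = cp_conj X (su3 x)"
proof -
  have "linear (\<lambda>x. 2 *\<^sub>R hcoord (cp_conj X (su3 x)))"
    using linear_compose[OF linear_su3 linear_compose[OF linear_cp_conj[of X] linear_hcoord]]
    by (simp add: o_def linear_compose_scale_right)
  then have "cp_rot X *v x = 2 *\<^sub>R hcoord (cp_conj X (su3 x))"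
    by (metis cp_rot_def matrix_vector_mul)
  moreover have "cp_conj X (su3 x) = 2 *\<^sub>R su3 (hcoord (cp_conj X (su3 x)))"
    using hermitian_eq_su3[of "cp_conj X (su3 x)"] assms
    by (simp add: adj_mat_cp_conj adj_mat_su3 trace_cp_conj trace_su3)
  ultimately show ?thesis
    by (simp add: linear_cmul[OF linear_su3])
qed

lemma inj_su3: "su3 x = su3 y \<Longrightarrow> x = y"
  by (metis hcoord_su3 scaleR_left_imp_eq zero_neq_one divide_eq_0_iff zero_neq_numeral)

text \<open>The inner product is twice the trace of a product of \<open>su3\<close> matrices.
  \<open>cp_conj\<close> conjugates this trace, which is real.\<close>

lemma orthogonal_cp_rot:
  assumes "unitary X"
  shows "orthogonal_matrix (cp_rot X)"
proof -
  have "complex_of_real ((cp_rot X *v x) \<bullet> (cp_rot X *v y)) = of_real (x \<bullet> y)" for x y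
    using trace_su3_mult[of "cp_rot X *v x" "cp_rot X *v y"]
    by (simp add: su3_cp_rot assms cp_conj_mult trace_cp_conj trace_su3_mult)
  then have "orthogonal_transformation ((*v) (cp_rot X))"
    by (simp add: orthogonal_transformation_def matrix_vector_mul_linear)
  then show ?thesis
    by (simp add: orthogonal_transformation_matrix)
qed

lemma hcoord_mat_1: "hcoord (mat 1) = 0"
  by (simp add: hcoord_def trace_gen vec_eq_iff)

text \<open>The identity component of \<open>H\<close> is fixed by \<open>cp_conj\<close> and
  invisible to \<open>hcoord\<close>, so only the traceless part matters.\<close>

lemma hcoord_cp_conj:
  assumes "unitary X" "adj_mat H = H"
  shows "hcoord (cp_conj X H) = cp_rot X *v hcoord H"
proof -
  have "cp_conj X H = (Re (trace H) / 3) *\<^sub>R mat 1 + 2 *\<^sub>R su3 (cp_rot X *v hcoord H)"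
    by (subst hermitian_eq_su3[OF assms(2)])
      (simp add: linear_add[OF linear_cp_conj] linear_cmul[OF linear_cp_conj]
        cp_conj_mat_1 su3_cp_rot assms)
  then show ?thesis
    by (simp add: linear_add[OF linear_hcoord] linear_cmul[OF linear_hcoord] hcoord_mat_1 hcoord_su3)
qed

subsection \<open>Invariance of the d-tensor\<close>

text \<open>Contracting the first index with a test vector \<open>z\<close> turns statements about
  the three-index tensor into matrix algebra.\<close>

definition d_mat :: "real^8 \<Rightarrow> real^8^8" where
  "d_mat z = (\<chi> j k. \<Sum>i\<in>UNIV. z $ i * d_tensor i j k)"

text \<open>The defining relation of the d-tensor, extended bilinearly from the generators.\<close>

lemma su3_anticommutator:
  "su3 z ** su3 x + su3 x ** su3 z = (z \<bullet> x / 3) *\<^sub>R mat 1 + su3 (x v* d_mat z)"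
proof -
  have prod: "su3 p ** su3 q = (\<Sum>i\<in>UNIV. \<Sum>j\<in>UNIV. (p $ i * q $ j) *\<^sub>R (gen i ** gen j))" for p q
    by (simp add: su3_def linear_sum[OF linear_matrix_mult_left]
        linear_sum[OF linear_matrix_mult_right] linear_cmul[OF linear_matrix_mult_left]
        linear_cmul[OF linear_matrix_mult_right] scaleR_sum_right)
      (subst sum.swap, simp add: mult.commute)
  have "su3 z ** su3 x + su3 x ** su3 z =
      (\<Sum>i\<in>UNIV. \<Sum>j\<in>UNIV. (z $ i * x $ j) *\<^sub>R (gen i ** gen j)) +
      (\<Sum>i\<in>UNIV. \<Sum>j\<in>UNIV. (z $ i * x $ j) *\<^sub>R (gen j ** gen i))"
    unfolding prod by (subst (3) sum.swap) (simp add: mult.commute)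
  also have "\<dots> = (\<Sum>i\<in>UNIV. \<Sum>j\<in>UNIV. (z $ i * x $ j) *\<^sub>R (gen i ** gen j + gen j ** gen i))"
    by (simp add: sum.distrib scaleR_add_right)
  also have "\<dots> = (\<Sum>i\<in>UNIV. \<Sum>j\<in>UNIV. (z $ i * x $ j) *\<^sub>R
      ((if i = j then 1/3 else 0) *\<^sub>R mat 1 + (\<Sum>k\<in>UNIV. d_tensor i j k *\<^sub>R gen k)))"
    using d_tensor by (simp add: is_d_tensor_def)
  also have "\<dots> = (\<Sum>i\<in>UNIV. \<Sum>j\<in>UNIV. (if i = j then z $ i * x $ j / 3 else 0) *\<^sub>R mat 1) +
      (\<Sum>i\<in>UNIV. \<Sum>j\<in>UNIV. \<Sum>k\<in>UNIV. (z $ i * x $ j * d_tensor i j k) *\<^sub>R gen k)"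
    unfolding sum.distrib[symmetric]
    by (intro sum.cong refl) (simp add: scaleR_add_right scaleR_sum_right)
  also have "(\<Sum>i\<in>UNIV. \<Sum>j\<in>UNIV. (if i = j then z $ i * x $ j / 3 else 0) *\<^sub>R mat 1) =
      (z \<bullet> x / 3) *\<^sub>R (mat 1 :: complex^3^3)"
    by (simp only: scaleR_left.sum[symmetric]) (simp add: inner_vec_def sum_divide_distrib)
  also have "(\<Sum>i\<in>UNIV. \<Sum>j\<in>UNIV. \<Sum>k\<in>UNIV. (z $ i * x $ j * d_tensor i j k) *\<^sub>R gen k) =
      (\<Sum>k\<in>UNIV. \<Sum>j\<in>UNIV. \<Sum>i\<in>UNIV. (z $ i * x $ j * d_tensor i j k) *\<^sub>R gen k)"
    by (subst (2) sum.swap, subst sum.swap, subst (2) sum.swap, rule refl)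
  also have "\<dots> = su3 (x v* d_mat z)"
    by (simp add: su3_def vector_matrix_mult_def d_mat_def scaleR_left.sum sum_distrib_left
        sum_distrib_right ac_simps)
  finally show ?thesis .
qed

text \<open>A basis-free form of the d-tensor, from which its invariance can be read off. The
  identity term drops out because \<open>su3 y\<close> is traceless.\<close>

lemma inner_d_mat:
  "complex_of_real (x \<bullet> (d_mat z *v y)) = 2 * trace ((su3 z ** su3 x + su3 x ** su3 z) ** su3 y)"
  by (simp add: su3_anticommutator linear_add[OF linear_matrix_mult_left]
      linear_cmul[OF linear_matrix_mult_left] linear_add[OF linear_trace]
      linear_cmul[OF linear_trace] trace_su3 trace_su3_mult dot_lmul_matrix)

lemma inner_d_product: "z \<bullet> d_product x y = x \<bullet> (d_mat z *v y)"
proof -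
  have "z \<bullet> d_product x y = (\<Sum>i\<in>UNIV. \<Sum>j\<in>UNIV. \<Sum>k\<in>UNIV. z $ i * d_tensor i j k * x $ j * y $ k)"
    by (simp add: inner_vec_def d_product_def sum_distrib_left ac_simps)
  also have "\<dots> = (\<Sum>j\<in>UNIV. \<Sum>k\<in>UNIV. \<Sum>i\<in>UNIV. z $ i * d_tensor i j k * x $ j * y $ k)"
    by (subst sum.swap, subst (2) sum.swap, rule refl)
  also have "\<dots> = x \<bullet> (d_mat z *v y)"
    by (simp add: inner_vec_def d_mat_def matrix_vector_mult_def sum_distrib_left sum_distrib_right ac_simps)
  finally show ?thesis .
qed

text \<open>Expresses K through the functional that it represents, so that cyclicity of the trace
  becomes available.\<close>

lemma inner_K_vec: "z \<bullet> K_vec A n = trace (transpose (d_mat z) ** mat_pow A n)"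
proof -
  have "z \<bullet> K_vec A n = (\<Sum>i\<in>UNIV. \<Sum>j\<in>UNIV. \<Sum>k\<in>UNIV. z $ i * d_tensor i j k * mat_pow A n $ j $ k)"
    by (simp add: inner_vec_def K_vec_def sum_distrib_left ac_simps)
  also have "\<dots> = (\<Sum>k\<in>UNIV. \<Sum>j\<in>UNIV. \<Sum>i\<in>UNIV. z $ i * d_tensor i j k * mat_pow A n $ j $ k)"
    by (subst (2) sum.swap, subst sum.swap, subst (2) sum.swap, rule refl)
  also have "\<dots> = trace (transpose (d_mat z) ** mat_pow A n)"
    by (simp add: trace_def transpose_def matrix_matrix_mult_def d_mat_def
        sum_distrib_left sum_distrib_right ac_simps)
  finally show ?thesis .
qed

lemma d_mat_cp_rot:
  assumes "unitary X"
  shows "(cp_rot X *v x) \<bullet> (d_mat (cp_rot X *v z) *v (cp_rot X *v y)) = x \<bullet> (d_mat z *v y)"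
proof -
  have "complex_of_real ((cp_rot X *v x) \<bullet> (d_mat (cp_rot X *v z) *v (cp_rot X *v y))) =
      2 * trace (cp_conj X ((su3 z ** su3 x + su3 x ** su3 z) ** su3 y))"
    unfolding inner_d_mat su3_cp_rot[OF assms]
    by (simp add: cp_conj_mult[OF assms] linear_add[OF linear_cp_conj, symmetric])
  also have "\<dots> = cnj (complex_of_real (x \<bullet> (d_mat z *v y)))"
    unfolding inner_d_mat by (simp add: trace_cp_conj[OF assms])
  finally show ?thesis by simp
qed

lemma inner_transpose_matrix: "x \<bullet> (transpose A *v y) = (A *v x) \<bullet> (y :: real^'n)"
  by (metis dot_lmul_matrix inner_commute transpose_matrix_vector)

lemma transpose_d_mat_cp_rot:
  assumes "unitary X"
  shows "transpose (cp_rot X) ** d_mat (cp_rot X *v z) ** cp_rot X = d_mat z"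
proof -
  let ?R = "cp_rot X"
  have "x \<bullet> ((transpose ?R ** d_mat (?R *v z) ** ?R) *v y) = x \<bullet> (d_mat z *v y)" for x y
    unfolding d_mat_cp_rot[OF assms, of x z y, symmetric]
    by (simp only: matrix_vector_mul_assoc[symmetric] inner_transpose_matrix)
  then show ?thesis
    by (metis matrix_eq vector_eq_ldot)
qed

lemma mat_pow_commute:
  assumes "A ** R = R ** A"
  shows "mat_pow A n ** R = R ** mat_pow A n"
proof (induction n)
  case 0
  then show ?case by (simp add: mat_pow_def)
next
  case (Suc n)
  have "mat_pow A (Suc n) ** R = A ** (mat_pow A n ** R)"
    by (simp add: mat_pow_def matrix_mul_assoc)
  also have "\<dots> = (A ** R) ** mat_pow A n"
    by (simp add: Suc matrix_mul_assoc)
  also have "\<dots> = R ** mat_pow A (Suc n)"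
    by (simp add: assms mat_pow_def matrix_mul_assoc)
  finally show ?case .
qed

section \<open>Vectors fixed by the rotation: the vectors K and d-products\<close>

lemma cp_rot_orthogonal:
  assumes "unitary X"
  shows "cp_rot X ** transpose (cp_rot X) = mat 1" "transpose (cp_rot X) ** cp_rot X = mat 1"
    "transpose (cp_rot X) *v (cp_rot X *v x) = x"
    "cp_rot X *v (transpose (cp_rot X) *v x) = x"
  using orthogonal_cp_rot[OF assms]
  by (simp_all only: orthogonal_matrix_def matrix_vector_mul_assoc matrix_vector_mul_lid)

lemma cp_rot_inner:
  assumes "unitary X"
  shows "(cp_rot X *v x) \<bullet> (cp_rot X *v y) = x \<bullet> y"
  by (metis assms cp_rot_orthogonal(3) dot_lmul_matrix transpose_matrix_vector)

text \<open>Vectors defined through the d-tensor are known by their inner products, so being fixed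
  is tested on functionals. For the converse, orthogonality makes every vector an image under the
  rotation.\<close>

lemma cp_rot_fixed_iff_inner:
  assumes "unitary X"
  shows "cp_rot X *v x = x \<longleftrightarrow> (\<forall>z. (cp_rot X *v z) \<bullet> x = z \<bullet> x)"
proof
  assume "cp_rot X *v x = x"
  then show "\<forall>z. (cp_rot X *v z) \<bullet> x = z \<bullet> x"
    by (metis assms cp_rot_inner)
next
  assume "\<forall>z. (cp_rot X *v z) \<bullet> x = z \<bullet> x"
  then have "(cp_rot X *v z) \<bullet> x = (cp_rot X *v z) \<bullet> (cp_rot X *v x)" for z
    by (simp add: cp_rot_inner[OF assms])
  then have "z \<bullet> x = z \<bullet> (cp_rot X *v x)" for z
    by (metis assms cp_rot_orthogonal(4))
  then show "cp_rot X *v x = x"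
    by (metis vector_eq_ldot)
qed

lemma cp_rot_K_vec:
  assumes X: "unitary X" and comm: "A ** cp_rot X = cp_rot X ** A"
  shows "cp_rot X *v K_vec A n = K_vec A n"
  unfolding cp_rot_fixed_iff_inner[OF X]
proof
  fix z
  let ?R = "cp_rot X"
  let ?B = "mat_pow A n"
  have "z \<bullet> K_vec A n = trace (transpose (transpose ?R ** d_mat (?R *v z) ** ?R) ** ?B)"
    by (simp add: inner_K_vec transpose_d_mat_cp_rot[OF X])
  also have "\<dots> = trace (transpose ?R ** (transpose (d_mat (?R *v z)) ** (?R ** ?B)))"
    by (simp add: matrix_transpose_mul matrix_mul_assoc)
  also have "\<dots> = trace (transpose (d_mat (?R *v z)) ** (?R ** ?B) ** transpose ?R)"
    by (rule trace_mul_sym)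
  \<comment> \<open>Commutation moves the rotation past the power of \<open>A\<close>, where it
    meets its transpose and cancels.\<close>
  also have "\<dots> = trace (transpose (d_mat (?R *v z)) ** ?B ** (?R ** transpose ?R))"
    by (simp add: mat_pow_commute[OF comm, symmetric] matrix_mul_assoc)
  also have "\<dots> = (?R *v z) \<bullet> K_vec A n"
    by (simp add: inner_K_vec cp_rot_orthogonal[OF X])
  finally show "(?R *v z) \<bullet> K_vec A n = z \<bullet> K_vec A n" ..
qed

lemma cp_rot_d_product:
  assumes X: "unitary X" and x: "cp_rot X *v x = x" and y: "cp_rot X *v y = y"
  shows "cp_rot X *v d_product x y = d_product x y"
  unfolding cp_rot_fixed_iff_inner[OF X] inner_d_product
  using d_mat_cp_rot[OF X, of x _ y] by (simp add: x y)

subsection \<open>Uniqueness of the coefficients of the potential\<close>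

text \<open>The indices are swapped so that a neutral vacuum yields the outer product of
  \<open>v\<close> with itself and CP acts as \<open>cp_conj\<close>.\<close>

definition gram :: "doublets \<Rightarrow> complex^3^3" where
  "gram \<phi> = (\<chi> a b. doublet_prod (\<phi> $ b) (\<phi> $ a))"

lemma adj_mat_gram: "adj_mat (gram \<phi>) = gram \<phi>"
  by (simp add: adj_mat_def transpose_def cnj_mat_def gram_def cnj_doublet_prod vec_eq_iff)

lemma bilin_gram: "bilin \<phi> = hcoord (gram \<phi>)"
proof -
  have "trace (gram \<phi> ** gen k) =
      (\<Sum>a\<in>UNIV. \<Sum>b\<in>UNIV. gen k $ a $ b * doublet_prod (\<phi> $ a) (\<phi> $ b))" for k
    unfolding trace_mult by (subst sum.swap) (simp add: gram_def mult.commute)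
  then show ?thesis
    by (simp add: bilin_def hcoord_def vec_eq_iff)
qed

lemma bilin0_gram: "bilin0 \<phi> = Re (trace (gram \<phi>)) / sqrt 3"
  by (simp add: bilin0_def trace_def gram_def)

lemma gram_cp_transform: "gram (cp_transform X \<phi>) = cp_conj X (gram \<phi>)"
  by (simp add: vec_eq_iff gram_def cp_conj_def cp_transform_def cnj_vec_def cnj_mat_def
      adj_mat_def transpose_def matrix_matrix_mult_def doublet_prod_def sum_3 sum_2 algebra_simps)

lemma bilin_cp_transform:
  assumes "unitary X"
  shows "bilin (cp_transform X \<phi>) = cp_rot X *v bilin \<phi>"
  by (simp add: bilin_gram gram_cp_transform hcoord_cp_conj assms adj_mat_gram)

lemma bilin0_cp_transform:
  assumes "unitary X"
  shows "bilin0 (cp_transform X \<phi>) = bilin0 \<phi>"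
  by (simp add: bilin0_gram gram_cp_transform trace_cp_conj assms)

lemma gram_scaleR: "gram (s *\<^sub>R \<phi>) = s\<^sup>2 *\<^sub>R gram \<phi>"
  by (simp add: gram_def doublet_prod_def vec_eq_iff sum_2 algebra_simps power2_eq_square)

lemma bilin_scaleR: "bilin (s *\<^sub>R \<phi>) = s\<^sup>2 *\<^sub>R bilin \<phi>"
  by (simp add: bilin_gram gram_scaleR linear_cmul[OF linear_hcoord])

lemma bilin0_scaleR: "bilin0 (s *\<^sub>R \<phi>) = s\<^sup>2 * bilin0 \<phi>"
  by (simp add: bilin0_gram gram_scaleR linear_cmul[OF linear_trace])

text \<open>Using both doublet components makes the Gram matrix a sum of two outer products, hence
  the bilinears additive in \<open>v\<close> and \<open>w\<close>.\<close>

definition two_vacua :: "complex^3 \<Rightarrow> complex^3 \<Rightarrow> doublets" where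
  "two_vacua v w = (\<chi> a. vector [v $ a, w $ a])"

lemma gram_two_vacua:
  "gram (two_vacua v w) = gram (neutral_vacuum v) + gram (neutral_vacuum w)"
  by (simp add: gram_def two_vacua_def neutral_vacuum_def doublet_prod_def sum_2 vec_eq_iff)

lemma bilin_two_vacua: "bilin (two_vacua v w) = vev_bilin v + vev_bilin w"
  by (simp add: bilin_neutral_vacuum[symmetric] bilin_gram gram_two_vacua linear_add[OF linear_hcoord])

lemma bilin0_two_vacua:
  "bilin0 (two_vacua v w) = bilin0 (neutral_vacuum v) + bilin0 (neutral_vacuum w)"
  by (simp add: bilin0_gram gram_two_vacua linear_add[OF linear_trace] add_divide_distrib)

text \<open>The outer products of vectors with themselves span the nine-dimensional real space of
  Hermitian matrices. Nine vectors suffice: the unit vectors e_a, and e_a + e_b and e_a + \<i> e_b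
  for a < b.\<close>

lemma vev_functional_eq_0:
  assumes "\<And>w. c0 * bilin0 (neutral_vacuum w) + c \<bullet> vev_bilin w = 0"
  shows "c0 = 0" "c = 0"
proof -
  \<comment> \<open>Naming the irrational factor lets \<open>linarith\<close> treat
    \<open>c0 * s\<close> and \<open>c $ 8 * s\<close> as atoms.\<close>
  define s where "s = 1 / sqrt 3"
  have s: "s \<noteq> 0" by (simp add: s_def)
  have eq: "c0 * (s * ((cmod (w $ 1))\<^sup>2 + (cmod (w $ 2))\<^sup>2 + (cmod (w $ 3))\<^sup>2)) +
      c $ 1 * Re (cnj (w $ 1) * w $ 2) + c $ 2 * Im (cnj (w $ 1) * w $ 2) +
      c $ 3 * ((cmod (w $ 1))\<^sup>2 - (cmod (w $ 2))\<^sup>2) / 2 +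
      c $ 4 * Re (cnj (w $ 1) * w $ 3) + c $ 5 * Im (cnj (w $ 1) * w $ 3) +
      c $ 6 * Re (cnj (w $ 2) * w $ 3) + c $ 7 * Im (cnj (w $ 2) * w $ 3) +
      c $ 8 * (s * ((cmod (w $ 1))\<^sup>2 + (cmod (w $ 2))\<^sup>2 - 2 * (cmod (w $ 3))\<^sup>2)) / 2 = 0" for w :: "complex^3"
    using assms[of w] unfolding bilin_neutral_vacuum[symmetric]
    by (simp add: inner_vec_def sum_8 bilin0_def bilin_def doublet_prod_def neutral_vacuum_def
      sum_2 sum_3 gen_def gell_mann_simps s_def[symmetric] cmod_power2)
     (simp add: algebra_simps power2_eq_square add_divide_distrib diff_divide_distrib)
  note e = eq[of "vector [1, 0, 0]"] eq[of "vector [0, 1, 0]"] eq[of "vector [0, 0, 1]"]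
  have e1: "c0 * s + c $ 3 / 2 + c $ 8 * s / 2 = 0"
    and e2: "c0 * s - c $ 3 / 2 + c $ 8 * s / 2 = 0"
    and e3: "c0 * s - c $ 8 * s = 0"
    using e by simp_all
  then have "c0 * s = 0" "c $ 8 * s = 0" and c3: "c $ 3 = 0"
    by linarith+
  then have c08: "c0 = 0" "c $ 8 = 0"
    using s by simp_all
  then show "c0 = 0" by simp
  have "c $ 1 = 0" "c $ 2 = 0" "c $ 4 = 0" "c $ 5 = 0" "c $ 6 = 0" "c $ 7 = 0"
    using eq[of "vector [1, 1, 0]"] eq[of "vector [1, \<i>, 0]"]
      eq[of "vector [1, 0, 1]"] eq[of "vector [1, 0, \<i>]"]
      eq[of "vector [0, 1, 1]"] eq[of "vector [0, 1, \<i>]"]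
    by (simp_all add: c08 c3)
  then show "c = 0"
    by (simp add: vec_eq_iff forall_8 c08 c3)
qed

lemma bilinear_form_eq:
  "bilinear_form M0 M \<Lambda>0 L \<Lambda> \<phi> = M0 * bilin0 \<phi> + M \<bullet> bilin \<phi> + \<Lambda>0 * (bilin0 \<phi>)\<^sup>2 +
    bilin0 \<phi> * (L \<bullet> bilin \<phi>) + bilin \<phi> \<bullet> (\<Lambda> *v bilin \<phi>)"
  by (simp add: bilinear_form_def inner_vec_def matrix_vector_mult_def sum_distrib_left ac_simps)

text \<open>Meant for the difference between a potential and its CP transform, where the terms in
  \<open>bilin0\<close> alone cancel.\<close>

lemma bilinear_form_zero:
  assumes zero: "\<And>\<phi>. m \<bullet> bilin \<phi> + bilin0 \<phi> * (l \<bullet> bilin \<phi>) + bilin \<phi> \<bullet> (N *v bilin \<phi>) = 0"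
    and sym: "transpose N = N"
  shows "m = 0" "l = 0" "N = 0"
proof -
  define q where "q \<phi> = bilin0 \<phi> * (l \<bullet> bilin \<phi>) + bilin \<phi> \<bullet> (N *v bilin \<phi>)" for \<phi>
  \<comment> \<open>Doubling the fields scales the quadratic part by 4 and the quartic part by 16,
    which separates them.\<close>
  have "m \<bullet> bilin \<phi> + q \<phi> = 0" "4 * (m \<bullet> bilin \<phi>) + 16 * q \<phi> = 0" for \<phi>
    using zero[of \<phi>] zero[of "2 *\<^sub>R \<phi>"]
    by (simp_all add: q_def bilin_scaleR bilin0_scaleR matrix_vector_mult_scaleR)
  then have m0: "m \<bullet> bilin \<phi> = 0" and q0: "q \<phi> = 0" for \<phi>
    by (smt (verit))+
  show "m = 0"
    using vev_functional_eq_0(2)[of 0 m] m0[of "neutral_vacuum _"]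
    by (simp add: bilin_neutral_vacuum)
  \<comment> \<open>A rank-two configuration polarizes the quadratic form; neutral vacua alone would not give this.\<close>
  have polar: "(l \<bullet> vev_bilin v) * bilin0 (neutral_vacuum w) +
      (bilin0 (neutral_vacuum v) *\<^sub>R l + 2 *\<^sub>R (N *v vev_bilin v)) \<bullet> vev_bilin w = 0" for v w
  proof -
    have "vev_bilin v \<bullet> (N *v vev_bilin w) = (N *v vev_bilin v) \<bullet> vev_bilin w"
      using inner_transpose_matrix[of "vev_bilin v" N "vev_bilin w"] by (simp add: sym)
    moreover have "q (two_vacua v w) - q (neutral_vacuum v) - q (neutral_vacuum w) = 0"
      by (simp add: q0)
    ultimately show ?thesis
      by (simp add: q_def bilin_two_vacua bilin0_two_vacua bilin_neutral_vacuum inner_add_left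
          inner_add_right matrix_vector_right_distrib algebra_simps inner_commute)
  qed
  \<comment> \<open>For fixed \<open>v\<close>, \<open>polar\<close> is a functional of
    \<open>w\<close> of the form treated above, so both of its coefficients vanish.\<close>
  have "l \<bullet> vev_bilin v = 0" for v
    using vev_functional_eq_0(1)[OF polar] .
  then show "l = 0"
    using vev_functional_eq_0(2)[of 0 l] by simp
  then have "N *v vev_bilin v = 0" for v
    using vev_functional_eq_0(2)[OF polar, of v] by simp
  then have "(N *v z) \<bullet> vev_bilin v = 0" for z v
    using inner_transpose_matrix[of z N "vev_bilin v"] by (simp add: sym)
  then have "N *v z = 0" for z
    using vev_functional_eq_0(2)[of 0 "N *v z"] by simp
  then show "N = 0"
    by (simp add: matrix_eq)
qed

lemma bilinear_form_invariant:
  assumes X: "unitary X" and sym: "transpose \<Lambda> = \<Lambda>"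
    and inv: "\<And>\<phi>. bilinear_form M0 M \<Lambda>0 L \<Lambda> (cp_transform X \<phi>) = bilinear_form M0 M \<Lambda>0 L \<Lambda> \<phi>"
  shows "cp_rot X *v M = M" "cp_rot X *v L = L" "\<Lambda> ** cp_rot X = cp_rot X ** \<Lambda>"
proof -
  let ?R = "cp_rot X"
  \<comment> \<open>These are the coefficients of the transformed potential minus the original
    ones.\<close>
  define m l N where "m = transpose ?R *v M - M" and "l = transpose ?R *v L - L"
    and "N = transpose ?R ** \<Lambda> ** ?R - \<Lambda>"
  have N: "x \<bullet> (N *v x) = (?R *v x) \<bullet> (\<Lambda> *v (?R *v x)) - x \<bullet> (\<Lambda> *v x)" for x
    unfolding N_def matrix_vector_mult_diff_rdistrib matrix_vector_mul_assoc[symmetric]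
      inner_diff_right inner_transpose_matrix ..
  have ml: "m \<bullet> x = M \<bullet> (?R *v x) - M \<bullet> x" "l \<bullet> x = L \<bullet> (?R *v x) - L \<bullet> x" for x
    unfolding m_def l_def inner_diff_left
    by (metis inner_commute inner_transpose_matrix)+
  have "m \<bullet> bilin \<phi> + bilin0 \<phi> * (l \<bullet> bilin \<phi>) + bilin \<phi> \<bullet> (N *v bilin \<phi>) = 0" for \<phi>
    using inv[of \<phi>]
    unfolding bilinear_form_eq bilin_cp_transform[OF X] bilin0_cp_transform[OF X] N ml
    by (simp add: algebra_simps)
  moreover have "transpose N = N"
  proof -
    have "transpose (A - B) = transpose A - transpose B" for A B :: "real^8^8"
      by (simp add: transpose_def vec_eq_iff)
    then show ?thesis
      by (simp add: N_def matrix_transpose_mul sym matrix_mul_assoc)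
  qed
  ultimately have "m = 0" "l = 0" "N = 0"
    by (rule bilinear_form_zero)+
  then have M: "transpose ?R *v M = M" and L: "transpose ?R *v L = L"
    and \<Lambda>: "transpose ?R ** \<Lambda> ** ?R = \<Lambda>"
    by (simp_all add: m_def l_def N_def del: transpose_matrix_vector)
  show "?R *v M = M" "?R *v L = L"
    using cp_rot_orthogonal(4)[OF X, of M] cp_rot_orthogonal(4)[OF X, of L] by (simp_all only: M L)
  have "?R ** \<Lambda> = (?R ** transpose ?R) ** (\<Lambda> ** ?R)"
    by (subst \<Lambda>[symmetric]) (simp only: matrix_mul_assoc)
  then show "\<Lambda> ** ?R = ?R ** \<Lambda>"
    by (simp add: cp_rot_orthogonal[OF X])
qed

subsection \<open>The vacuum\<close>

lemma cp_transform_neutral_vacuum: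
  "cp_transform X (neutral_vacuum v) = neutral_vacuum (X *v cnj_vec v)"
  by (simp add: vec_eq_iff cp_transform_def neutral_vacuum_def cnj_vec_def forall_2
      matrix_vector_mult_def)

lemma gram_neutral_vacuum: "gram (neutral_vacuum v) = (\<chi> a b. v $ a * cnj (v $ b))"
  by (simp add: gram_def neutral_vacuum_def doublet_prod_def sum_2 vec_eq_iff)

lemma cp_rot_vev_bilin:
  "unitary X \<Longrightarrow> cp_rot X *v vev_bilin v = vev_bilin (X *v cnj_vec v)"
  by (metis bilin_cp_transform bilin_neutral_vacuum cp_transform_neutral_vacuum)

lemma gram_eqI:
  assumes "bilin \<phi> = bilin \<psi>" "Re (trace (gram \<phi>)) = Re (trace (gram \<psi>))"
  shows "gram \<phi> = gram \<psi>"
  using hermitian_eq_su3[OF adj_mat_gram, of \<phi>] hermitian_eq_su3[OF adj_mat_gram, of \<psi>] assms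
  by (simp add: bilin_gram)

text \<open>Otherwise the outer product of \<open>v\<close> with itself, of rank one, would be a
  multiple of the 3x3 identity.\<close>

lemma vev_bilin_nonzero:
  assumes "v \<noteq> 0"
  shows "vev_bilin v \<noteq> 0"
proof
  assume "vev_bilin v = 0"
  then obtain t where "gram (neutral_vacuum v) = t *\<^sub>R mat 1"
    using hermitian_eq_su3[OF adj_mat_gram, of "neutral_vacuum v"]
    by (auto simp: bilin_gram[symmetric] bilin_neutral_vacuum linear_0[OF linear_su3])
  then have g: "v $ a * cnj (v $ b) = (if a = b then of_real t else 0)" for a b
    by (simp add: gram_neutral_vacuum vec_eq_iff mat_def scaleR_conv_of_real[where 'a=complex])
  have "v $ a = 0" for a
  proof -
    \<comment> \<open>A second index: the off-diagonal entry forces one of the two components to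
      vanish, and the equal diagonal entries then force both.\<close>
    have "a + 1 \<noteq> a" by simp
    then show ?thesis
      using g[of a "a + 1"] g[of a a] g[of "a + 1" "a + 1"] by auto
  qed
  with assms show False by (simp add: vec_eq_iff)
qed

lemma outer_eq_imp_phase:
  fixes u v :: "complex^'n"
  assumes "\<And>a b. u $ a * cnj (u $ b) = v $ a * cnj (v $ b)"
  shows "\<exists>\<theta>. u = cis \<theta> *s v"
proof (cases "v = 0")
  case True
  then have "u = 0"
    using assms[of a a for a] by (simp add: vec_eq_iff)
  with True show ?thesis by simp
next
  case False
  then obtain b where b: "v $ b \<noteq> 0"
    by (auto simp: vec_eq_iff)
  have ub: "cmod (u $ b) = cmod (v $ b)"
    using arg_cong[OF assms[of b b], of cmod] by (simp add: norm_mult power2_eq_iff_nonneg flip: power2_eq_square)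
  with b have ub0: "u $ b \<noteq> 0" by auto
  \<comment> \<open>Column \<open>b\<close> of the assumed identity, solved for \<open>u\<close>,
    gives this factor.\<close>
  define c where "c = cnj (v $ b) / cnj (u $ b)"
  have "cmod c = 1"
    using ub b by (simp add: c_def norm_divide)
  then have "c = cis (Arg c)"
    by (subst cis_Arg) (auto simp: sgn_div_norm)
  moreover have "u = c *s v"
    using assms[of _ b] ub0 by (simp add: c_def vec_eq_iff field_simps)
  ultimately show ?thesis by metis
qed

text \<open>The bilinears see only the traceless part of the outer product. The missing trace is the
  squared norm of \<open>v\<close>, which CP preserves.\<close>

lemma cp_conserved_iff_fixed:
  assumes "unitary X"
  shows "cp_conserved X v \<longleftrightarrow> cp_rot X *v vev_bilin v = vev_bilin v"
proof
  assume "cp_conserved X v"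
  then obtain \<theta> where "X *v cnj_vec v = cis \<theta> *s v"
    by (auto simp: cp_conserved_def)
  then have "gram (neutral_vacuum (X *v cnj_vec v)) = gram (neutral_vacuum v)"
    by (simp add: gram_neutral_vacuum vec_eq_iff cis_cnj cis_mult ac_simps)
  then show "cp_rot X *v vev_bilin v = vev_bilin v"
    by (metis assms bilin_gram bilin_neutral_vacuum cp_rot_vev_bilin)
next
  assume "cp_rot X *v vev_bilin v = vev_bilin v"
  then have "gram (neutral_vacuum (X *v cnj_vec v)) = gram (neutral_vacuum v)"
  proof (intro gram_eqI)
    show "Re (trace (gram (neutral_vacuum (X *v cnj_vec v)))) = Re (trace (gram (neutral_vacuum v)))"
      by (simp add: cp_transform_neutral_vacuum[symmetric] gram_cp_transform trace_cp_conj assms)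
  qed (simp add: bilin_neutral_vacuum cp_rot_vev_bilin assms)
  then show "cp_conserved X v"
    unfolding cp_conserved_def
    by (intro outer_eq_imp_phase) (simp add: gram_neutral_vacuum vec_eq_iff)
qed

subsection \<open>Hermitian matrices invariant under a CP4 transformation\<close>

definition cdot :: "complex^'n \<Rightarrow> complex^'n \<Rightarrow> complex" where
  "cdot x y = (\<Sum>a\<in>UNIV. cnj (x $ a) * y $ a)"

lemma cdot_simps:
  "cdot x (c *s y) = c * cdot x y" "cdot (c *s x) y = cnj c * cdot x y"
  "cdot x (- y) = - cdot x y" "cdot (- x) y = - cdot x y"
  by (simp_all add: cdot_def sum_distrib_left algebra_simps sum_negf)

lemma cnj_cdot: "cnj (cdot x y) = cdot y x"
  by (simp add: cdot_def mult.commute)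

lemma cdot_self: "cdot x x = complex_of_real ((norm x)\<^sup>2)"
  by (simp add: cdot_def norm_vec_def L2_set_def sum_nonneg complex_norm_square mult.commute
      del: of_real_power)

lemma cdot_adj_mat: "cdot (A *v x) y = cdot x (adj_mat A *v y)"
proof -
  have "cdot (A *v x) y = (\<Sum>a\<in>UNIV. \<Sum>b\<in>UNIV. cnj (A $ a $ b) * cnj (x $ b) * y $ a)"
    by (simp add: cdot_def matrix_vector_mult_def sum_distrib_right)
  also have "\<dots> = cdot x (adj_mat A *v y)"
    by (subst sum.swap) (simp add: cdot_def matrix_vector_mult_def adj_mat_def transpose_def
        cnj_mat_def sum_distrib_left ac_simps)
  finally show ?thesis .
qed

lemma orthonormal_expansion:
  fixes b1 b2 b3 :: "complex^3"
  assumes "cdot b1 b1 = 1" "cdot b2 b2 = 1" "cdot b3 b3 = 1"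
    and "cdot b1 b2 = 0" "cdot b1 b3 = 0" "cdot b2 b3 = 0"
  shows "z = cdot b1 z *s b1 + cdot b2 z *s b2 + cdot b3 z *s b3"
proof -
  define U :: "complex^3^3" where "U = transpose (vector [b1, b2, b3])"
  have "cdot b2 b1 = 0" "cdot b3 b1 = 0" "cdot b3 b2 = 0"
    using assms by (metis cnj_cdot complex_cnj_zero)+
  with assms have "adj_mat U ** U = mat 1"
    by (simp add: U_def adj_mat_def cnj_mat_def transpose_def matrix_matrix_mult_def vec_eq_iff
        forall_3 mat_def cdot_def)
  then have "U ** adj_mat U = mat 1"
    by (simp add: matrix_left_right_inverse)
  then have "z = U *v (adj_mat U *v z)"
    by (simp add: matrix_vector_mul_assoc)
  also have "\<dots> = cdot b1 z *s b1 + cdot b2 z *s b2 + cdot b3 z *s b3"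
    by (simp add: U_def adj_mat_def cnj_mat_def transpose_def matrix_vector_mult_def vec_eq_iff
        sum_3 cdot_def algebra_simps)
  finally show ?thesis .
qed

lemma scaleR_matrix_mult_vec: "(c *\<^sub>R A) *v x = c *\<^sub>R (A *v (x :: complex^'n))"
  by (simp add: matrix_vector_mult_def vec_eq_iff scaleR_sum_right)

lemma cnj_vec_simps:
  "cnj_vec (A *v x) = cnj_mat A *v cnj_vec x" "cnj_vec (cnj_vec x) = x"
  "cnj_vec (c *s x) = cnj c *s cnj_vec x" "cnj_vec (- x) = - cnj_vec x"
  by (simp_all add: cnj_vec_def cnj_mat_def matrix_vector_mult_def vec_eq_iff)

lemma cdot_cnj_vec: "cdot (cnj_vec x) (cnj_vec y) = cdot y x"
  by (simp add: cdot_def cnj_vec_def mult.commute)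

lemma det_cnj_mat: "det (cnj_mat X :: complex^3^3) = cnj (det X)"
  by (simp add: det_3 cnj_mat_def)

text \<open>\<open>W\<close> is an involution, so x - W x and x + W x are eigenvectors for -1 and 1
  when nonzero; the first is nonzero for some x as W is not the identity.\<close>

lemma cp4_eigenvectors:
  fixes X :: "complex^3^3"
  defines "W \<equiv> X ** cnj_mat X"
  assumes "W \<noteq> mat 1" "W ** W = mat 1"
  obtains u w where "norm u = 1" "W *v u = - u" "norm w = 1" "W *v w = w"
proof -
  have WW: "W *v (W *v x) = x" for x
    using assms by (simp add: matrix_vector_mul_assoc)
  have unit: "\<exists>y. norm y = 1 \<and> W *v y = s *s y" if "W *v x = s *s x" "x \<noteq> 0" for x s
  proof (intro exI conjI)
    let ?y = "complex_of_real (1 / norm x) *s x"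
    have "?y = (1 / norm x) *\<^sub>R x"
      by (simp only: vec_eq_iff vector_smult_component vector_scaleR_component
          scaleR_conv_of_real[where 'a=complex] simp_thms)
    then show "norm ?y = 1"
      using that by simp
    show "W *v ?y = s *s ?y"
      by (simp add: vector_scalar_commute that vector_smult_assoc mult.commute)
  qed
  have "\<exists>x. W *v x \<noteq> x"
    using assms by (metis matrix_eq matrix_vector_mul_lid)
  then obtain x where x: "W *v x \<noteq> x" ..
  have "\<exists>u. norm u = 1 \<and> W *v u = (-1) *s u"
  proof (rule unit)
    show "W *v (x - W *v x) = (-1) *s (x - W *v x)"
      by (simp add: matrix_vector_mult_diff_distrib WW vec_eq_iff)
  qed (use x in simp)
  then obtain u where u: "norm u = 1" "W *v u = - u"
    by (auto simp: vec_eq_iff)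
  have "\<exists>x. W *v x \<noteq> - x"
  proof (rule ccontr)
    assume "\<not> ?thesis"
    then have "W = 0 - mat 1"
      unfolding matrix_eq matrix_vector_mult_diff_rdistrib by simp
    \<comment> \<open>In odd dimension the negative identity has determinant -1, whereas det W is
      the squared modulus of det X.\<close>
    then have "det W = -1"
      by (simp add: det_3 mat_def)
    then have "of_real ((cmod (det X))\<^sup>2) = complex_of_real (-1)"
      unfolding W_def by (simp add: det_mul det_cnj_mat complex_norm_square del: of_real_power)
    then have "(cmod (det X))\<^sup>2 = -1"
      by (simp only: of_real_eq_iff)
    then show False
      by (smt (verit) zero_le_power2)
  qed
  then obtain x where x: "W *v x \<noteq> - x" ..
  have "\<exists>w. norm w = 1 \<and> W *v w = 1 *s w"
  proof (rule unit)
    show "W *v (x + W *v x) = 1 *s (x + W *v x)"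
      by (simp add: matrix_vector_right_distrib WW)
    show "x + W *v x \<noteq> 0"
      using x by (metis add_eq_0_iff)
  qed
  then show thesis
    using u that by auto
qed

text \<open>The witness is 1 - 3 P, with P the orthogonal projection onto the line spanned by
  \<open>w\<close>. It has eigenvalue 1 on \<open>u\<close> and \<open>J u\<close> and -2 on
  \<open>w\<close>.\<close>

lemma cp4_invariant_hermitian:
  fixes X :: "complex^3^3"
  assumes X: "unitary X" and W: "X ** cnj_mat X \<noteq> mat 1"
    "(X ** cnj_mat X) ** (X ** cnj_mat X) = mat 1"
  obtains B where "\<And>H. adj_mat H = H \<Longrightarrow> cp_conj X H = H \<Longrightarrow> trace H = 0 \<Longrightarrow> \<exists>h. H = h *\<^sub>R B"
proof -
  define W where "W = X ** cnj_mat X"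
  define J where "J v = X *v cnj_vec v" for v
  have JJ: "J (J v) = W *v v" for v
    by (simp add: J_def W_def cnj_vec_simps matrix_vector_mul_assoc)
  have J_scale: "J (c *s v) = cnj c *s J v" for c v
    by (simp add: J_def cnj_vec_simps vector_scalar_commute)
  have J_cdot: "cdot (J x) (J y) = cdot y x" for x y
    using X by (simp add: J_def cdot_adj_mat matrix_vector_mul_assoc unitary_adj_mat cdot_cnj_vec)
  have W_cdot: "cdot (W *v x) (W *v y) = cdot x y" for x y
    by (simp add: JJ[symmetric] J_cdot)
  obtain u w where u: "norm u = 1" "W *v u = - u" and w: "norm w = 1" "W *v w = w"
    using cp4_eigenvectors[of X] W unfolding W_def by metis
  \<comment> \<open>\<open>W\<close> is an isometry, so eigenvectors for its different eigenvalues
    are orthogonal.\<close>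
  have ortho: "cdot p q = 0" if "W *v p = - p" "W *v q = q" for p q
    using W_cdot[of p q] by (simp add: that cdot_simps)
  have WJu: "W *v J u = - J u"
  proof -
    have "W *v J u = J (W *v u)" by (simp add: JJ[symmetric])
    then show ?thesis using J_scale[of "-1" u] by (simp add: u)
  qed
  \<comment> \<open>Kramers: antiunitarity and J (J u) = - u make this product equal to its own
    negative.\<close>
  have uJu: "cdot u (J u) = 0"
    using J_cdot[of "J u" u] by (simp add: JJ u cdot_simps)
  have norms: "cdot u u = 1" "cdot w w = 1"
    by (simp_all add: cdot_self u w)
  have expand: "z = cdot u z *s u + cdot (J u) z *s J u + cdot w z *s w" for z
    by (rule orthonormal_expansion)
      (simp_all add: norms u w J_cdot ortho WJu uJu)
  define P :: "complex^3^3" where "P = (\<chi> a b. w $ a * cnj (w $ b))"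
  have P: "P *v z = cdot w z *s w" for z
    by (simp add: P_def matrix_vector_mult_def vec_eq_iff cdot_def sum_distrib_left ac_simps)
  have "trace P = cdot w w"
    by (simp add: P_def trace_def cdot_def mult.commute)
  then have trP: "trace P = 1"
    by (simp add: cdot_self w)
  show thesis
  proof
    fix H assume H: "adj_mat H = H" "cp_conj X H = H" "trace H = 0"
    have "X ** cnj_mat H ** (adj_mat X ** X) = H ** X"
      using arg_cong[OF H(2), of "\<lambda>A. A ** X"] by (simp add: cp_conj_def matrix_mul_assoc)
    then have "X ** cnj_mat H = H ** X"
      using X by (simp add: unitary_adj_mat)
    then have HJ: "H *v J v = J (H *v v)" for v
      by (simp add: J_def cnj_vec_simps matrix_vector_mul_assoc)
    then have HW: "H *v (W *v v) = W *v (H *v v)" for v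
      by (simp add: JJ[symmetric])
    have H_cdot: "cdot (H *v x) y = cdot x (H *v y)" for x y
      by (simp add: cdot_adj_mat H)
    have WHu: "W *v (H *v u) = - (H *v u)"
      using HW[of u] by (simp add: u vec.neg)
    define h k where "h = Re (cdot u (H *v u))" and "k = Re (cdot w (H *v w))"
    have real: "cdot x (H *v x) = of_real (Re (cdot x (H *v x)))" for x
      by (metis H_cdot Reals_cnj_iff cnj_cdot of_real_Re)
    \<comment> \<open>The Kramers argument again, now with \<open>H\<close> moved across
      \<open>J\<close> and the inner product.\<close>
    have "cdot (J u) (H *v u) = - cdot (J u) (H *v u)"
    proof -
      have "cdot (J u) (H *v u) = cdot (J (H *v u)) u"
        by (simp add: H_cdot[symmetric] HJ)
      also have "\<dots> = - cdot (J (H *v u)) (J (J u))"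
        by (simp add: JJ u cdot_simps)
      also have "\<dots> = - cdot (J u) (H *v u)"
        by (simp only: J_cdot)
      finally show ?thesis .
    qed
    moreover have "cdot w (H *v u) = 0"
      using ortho[OF WHu w(2)] by (metis cnj_cdot complex_cnj_zero)
    ultimately have Hu: "H *v u = of_real h *s u"
      using expand[of "H *v u"] real[of u] by (simp add: h_def)
    \<comment> \<open>The antilinear \<open>J\<close> conjugates the eigenvalue, which is real, so
      \<open>J u\<close> shares it.\<close>
    have HJu: "H *v J u = of_real h *s J u"
      by (simp add: HJ Hu J_scale)
    have "cdot u (H *v w) = 0" "cdot (J u) (H *v w) = 0"
      by (simp_all add: H_cdot[symmetric] Hu HJu cdot_simps ortho u w WJu)
    then have Hw: "H *v w = of_real k *s w"
      using expand[of "H *v w"] real[of w] by (simp add: k_def)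
    have "H *v z = (h *\<^sub>R mat 1 + (k - h) *\<^sub>R P) *v z" for z
    proof -
      have "H *v z = cdot u z *s (H *v u) + cdot (J u) z *s (H *v J u) + cdot w z *s (H *v w)"
        by (subst expand[of z]) (simp only: matrix_vector_right_distrib vector_scalar_commute)
      also have "\<dots> = of_real h *s (cdot u z *s u + cdot (J u) z *s J u + cdot w z *s w)
          + of_real (k - h) *s (P *v z)"
        by (simp add: Hu HJu Hw P vec_eq_iff algebra_simps)
      also have "\<dots> = of_real h *s z + of_real (k - h) *s (P *v z)"
        by (simp only: expand[symmetric])
      also have "\<dots> = (h *\<^sub>R mat 1 + (k - h) *\<^sub>R P) *v z"
        by (simp add: matrix_vector_mult_add_rdistrib scaleR_matrix_mult_vec vec_eq_iff
            scaleR_conv_of_real[where 'a=complex] algebra_simps)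
      finally show ?thesis .
    qed
    then have eq: "H = h *\<^sub>R mat 1 + (k - h) *\<^sub>R P"
      by (simp add: matrix_eq)
    have "3 * h + (k - h) = 0"
      using H(3) unfolding eq
      by (simp add: linear_add[OF linear_trace] linear_cmul[OF linear_trace] trace_I trP complex_eq_iff)
    then have "k - h = - 3 * h" by linarith
    then have "H = h *\<^sub>R (mat 1 - 3 *\<^sub>R P)"
      unfolding eq by (simp add: algebra_simps)
    then show "\<exists>h. H = h *\<^sub>R (mat 1 - 3 *\<^sub>R P)" ..
  qed
qed

section \<open>The fixed line of a CP4 and the alignment criterion\<close>

lemma cp4_fixed_parallel:
  assumes X: "cp4_symmetry V X" and x: "cp_rot X *v x = x" and y: "cp_rot X *v y = y"
    and "y \<noteq> 0"
  shows "parallel x y"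
proof -
  have U: "unitary X" and W: "X ** cnj_mat X \<noteq> mat 1"
    "(X ** cnj_mat X) ** (X ** cnj_mat X) = mat 1"
    using X by (auto simp: cp4_symmetry_def cp_symmetry_def)
  obtain B where B: "\<And>H. adj_mat H = H \<Longrightarrow> cp_conj X H = H \<Longrightarrow> trace H = 0 \<Longrightarrow> \<exists>h. H = h *\<^sub>R B"
    using cp4_invariant_hermitian[OF U W] by blast
  have "\<exists>h. su3 z = h *\<^sub>R B" if "cp_rot X *v z = z" for z
    using B[of "su3 z"] su3_cp_rot[OF U, of z] by (simp add: that adj_mat_su3 trace_su3)
  with x y obtain h k where h: "su3 x = h *\<^sub>R B" and k: "su3 y = k *\<^sub>R B"
    by blast
  have "k \<noteq> 0"
    using k \<open>y \<noteq> 0\<close> inj_su3[of y 0] by (auto simp: linear_0[OF linear_su3])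
  then have "su3 x = su3 ((h / k) *\<^sub>R y)"
    by (simp add: linear_cmul[OF linear_su3] h k)
  then show ?thesis
    unfolding parallel_def using inj_su3 by blast
qed

theorem mainTheorem4:
  fixes V :: "doublets \<Rightarrow> real"
    and M0 \<Lambda>0 :: real
    and M L :: "real^8"
    and \<Lambda> :: "real^8^8"
    and X :: "complex^3^3"
    and v :: "complex^3"
  assumes "is_3hdm_potential V"
    and "\<forall>\<phi>. V \<phi> = bilinear_form M0 M \<Lambda>0 L \<Lambda> \<phi>"
    and "transpose \<Lambda> = \<Lambda>"
    and "cp4_symmetry V X"
    and "\<not> (\<exists>X'. cp2_symmetry V X')"
    and "M \<noteq> 0 \<or> L \<noteq> 0 \<or> (\<exists>n\<ge>1. K_vec \<Lambda> n \<noteq> 0)"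
    and "v \<noteq> 0"
  shows "(cp_conserved X v \<longleftrightarrow> vev_aligned M L \<Lambda> (vev_bilin v))
    \<and> (vev_aligned M L \<Lambda> (vev_bilin v) \<longrightarrow> is_eigenvector \<Lambda> (vev_bilin v))
    \<and> (\<not> vev_aligned M L \<Lambda> (vev_bilin v) \<longrightarrow> cp_spontaneously_broken X v)"
proof -
  let ?R = "cp_rot X" and ?r = "vev_bilin v"
  have X: "unitary X" and inv: "V (cp_transform X \<phi>) = V \<phi>" for \<phi>
    using assms(4) by (auto simp: cp4_symmetry_def cp_symmetry_def)
  have M: "?R *v M = M" and L: "?R *v L = L" and \<Lambda>: "\<Lambda> ** ?R = ?R ** \<Lambda>"
    using bilinear_form_invariant[OF X assms(3), of M0 M \<Lambda>0 L] inv assms(2) by simp_all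
  have K: "?R *v K_vec \<Lambda> n = K_vec \<Lambda> n" for n
    by (rule cp_rot_K_vec[OF X \<Lambda>])
  have r0: "?r \<noteq> 0"
    using assms(7) by (rule vev_bilin_nonzero)
  note par = cp4_fixed_parallel[OF assms(4)]
  \<comment> \<open>The d-product of \<open>?r\<close> with itself is fixed too, so self-alignment
    is one more case of parallel fixed vectors.\<close>
  have fixed_aligned: "vev_aligned M L \<Lambda> ?r" if r: "?R *v ?r = ?r"
    unfolding vev_aligned_def self_aligned_def
    using r0 par[OF r M] par[OF r L] par[OF r K] par[OF cp_rot_d_product[OF X r r] r] by blast
  \<comment> \<open>Some vector among \<open>M\<close>, \<open>L\<close> and the K is nonzero;
    \<open>?r\<close> is a multiple of it and inherits its invariance.\<close>
  have aligned_fixed: "?R *v ?r = ?r" if "vev_aligned M L \<Lambda> ?r"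
  proof -
    have "?R *v ?r = ?r" if "parallel ?r y" "?R *v y = y" for y
      using that by (auto simp: parallel_def matrix_vector_mult_scaleR)
    then show ?thesis
      using that assms(6) M L K unfolding vev_aligned_def by metis
  qed
  have eigenvector: "is_eigenvector \<Lambda> ?r" if r: "?R *v ?r = ?r"
  proof -
    \<comment> \<open>Commuting with the rotation, \<open>\<Lambda>\<close> maps the fixed line into
      itself.\<close>
    have "?R *v (\<Lambda> *v ?r) = \<Lambda> *v ?r"
      by (metis \<Lambda> matrix_vector_mul_assoc r)
    then show ?thesis
      using par[OF _ r r0] r0 unfolding is_eigenvector_def parallel_def by blast
  qed
  show ?thesis
    unfolding cp_spontaneously_broken_def cp_conserved_iff_fixed[OF X]
    using fixed_aligned aligned_fixed eigenvector by blast
qed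

end
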